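(* Let $\widehat{\mathcal S}$ be a Neumann subgroup of $\widehat{\mathcal M}=PGL(2,\mathbb Z)$ that is not contained in $\mathcal M=PSL(2,\mathbb Z)$, and let $\mathcal S=\widehat{\mathcal S}\cap\mathcal M$. Then $\mathcal S$ is a maximal nonparabolic subgroup of $\mathcal M$, and $\mathcal S$ is not a Neumann subgroup of $\mathcal M$.
   Context: $\mathcal M=PSL(2,\mathbb Z)$ is the modular group, a normal subgroup of index $2$ in the extended modular group $\widehat{\mathcal M}=PGL(2,\mathbb Z)$ (the elements of $\mathcal M$ are those of determinant $1$). In $\widehat{\mathcal M}$ put $\omega=\pm\begin{pmatrix}0&-1\\1&0\end{pmatrix}$, $\varphi=\pm\begin{pmatrix}0&-1\\1&1\end{pmatrix}$, $\nu=\pm\begin{pmatrix}-1&0\\0&1\end{pmatrix}$ and $\tau=\omega\varphi=\pm\begin{pmatrix}1&1\\0&1\end{pmatrix}$. Let $\mathcal T=\{\tau^n: n\in\mathbb Z\}$ and $\widehat{\mathcal T}=\{\tau^n\nu^\epsilon: n\in\mathbb Z,\ \epsilon\in\{0,1\}\}$ (the stabilizer of $\infty$ in $\widehat{\mathcal M}$). A Neumann subgroup of $\widehat{\mathcal M}$ is a subgroup $\widehat{\mathcal S}$ with $\widehat{\mathcal S}\,\widehat{\mathcal T}=\widehat{\mathcal M}$ and $\widehat{\mathcal S}\cap\widehat{\mathcal T}=1$. A Neumann subgroup of $\mathcal M$ is a subgroup $\mathcal U$ of $\mathcal M$ with $\mathcal U\,\mathcal T=\mathcal M$ and $\mathcal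 U\cap\mathcal T=1$. A parabolic element of $\mathcal M$ is a nontrivial element conjugate in $\mathcal M$ to some $\tau^n$, $n\in\mathbb Z$. A subgroup of $\mathcal M$ is nonparabolic if it contains no parabolic elements; it is maximal nonparabolic if it is nonparabolic and is not properly contained in any nonparabolic subgroup of $\mathcal M$. *)

theory Defs
  imports "HOL-Analysis.Determinants" "HOL-Algebra.Coset"
begin

definition GL2Z :: "(int^2^2) monoid" where
  "GL2Z = \<lparr>carrier = {A. invertible A}, mult = (**), one = mat 1\<rparr>"

text \<open>Elements of \<open>PGL2Z\<close> are the cosets \<open>{A, -A}\<close>.\<close>

definition PGL2Z :: "(int^2^2) set monoid" where
  "PGL2Z = GL2Z Mod {mat 1, - mat 1}"

definition pm :: "int^2^2 \<Rightarrow> (int^2^2) set" where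
  "pm A = {mat 1, - mat 1} #>\<^bsub>GL2Z\<^esub> A"

definition PSL2Z :: "(int^2^2) set monoid" where
  "PSL2Z = PGL2Z\<lparr>carrier := pm ` {A. det A = 1}\<rparr>"

definition mat2 :: "int \<Rightarrow> int \<Rightarrow> int \<Rightarrow> int \<Rightarrow> int^2^2" where
  "mat2 a b c d = vector [vector [a, b], vector [c, d]]"

definition omega :: "(int^2^2) set" where
  "omega = pm (mat2 0 (-1) 1 0)"

definition phi :: "(int^2^2) set" where
  "phi = pm (mat2 0 (-1) 1 1)"

definition nu :: "(int^2^2) set" where
  "nu = pm (mat2 (-1) 0 0 1)"

definition tau :: "(int^2^2) set" where
  "tau = omega \<otimes>\<^bsub>PGL2Z\<^esub> phi"

definition T_group :: "(int^2^2) set set" where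
  "T_group = {tau [^]\<^bsub>PGL2Z\<^esub> n | n :: int. True}"

definition T_hat :: "(int^2^2) set set" where
  "T_hat = {(tau [^]\<^bsub>PGL2Z\<^esub> n) \<otimes>\<^bsub>PGL2Z\<^esub> (nu [^]\<^bsub>PGL2Z\<^esub> e) | (n :: int) (e :: nat). e \<in> {0, 1}}"

text \<open>Used with \<open>G = PGL2Z\<close>, \<open>T = T_hat\<close> and with \<open>G = PSL2Z\<close>, \<open>T = T_group\<close>.\<close>

definition neumann_subgroup :: "('a, 'b) monoid_scheme \<Rightarrow> 'a set \<Rightarrow> 'a set \<Rightarrow> bool" where
  "neumann_subgroup G T U \<longleftrightarrow>
     subgroup U G \<and> U <#>\<^bsub>G\<^esub> T = carrier G \<and> U \<inter> T = {\<one>\<^bsub>G\<^esub>}"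

definition parabolic :: "(int^2^2) set \<Rightarrow> bool" where
  "parabolic g \<longleftrightarrow> g \<in> carrier PSL2Z \<and> g \<noteq> \<one>\<^bsub>PSL2Z\<^esub> \<and>
     (\<exists>h \<in> carrier PSL2Z. \<exists>n :: int.
        g = h \<otimes>\<^bsub>PSL2Z\<^esub> (tau [^]\<^bsub>PSL2Z\<^esub> n) \<otimes>\<^bsub>PSL2Z\<^esub> inv\<^bsub>PSL2Z\<^esub> h)"

definition nonparabolic_subgroup :: "(int^2^2) set set \<Rightarrow> bool" where
  "nonparabolic_subgroup H \<longleftrightarrow> subgroup H PSL2Z \<and> (\<forall>g \<in> H. \<not> parabolic g)"

definition maximal_nonparabolic :: "(int^2^2) set set \<Rightarrow> bool" where
  "maximal_nonparabolic H \<longleftrightarrow>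
     nonparabolic_subgroup H \<and> \<not> (\<exists>K. nonparabolic_subgroup K \<and> H \<subset> K)"

lemma group_GL2Z: "group GL2Z"
proof (rule groupI)
  fix x assume "x \<in> carrier GL2Z"
  then obtain y where "x ** y = mat 1" "y ** x = mat 1"
    by (auto simp: GL2Z_def invertible_def)
  then show "\<exists>y\<in>carrier GL2Z. y \<otimes>\<^bsub>GL2Z\<^esub> x = \<one>\<^bsub>GL2Z\<^esub>"
    by (auto simp: GL2Z_def invertible_def)
next
  show "\<one>\<^bsub>GL2Z\<^esub> \<in> carrier GL2Z"
    by (auto simp: GL2Z_def invertible_def intro!: exI[of _ "mat 1"])
qed (auto simp: GL2Z_def invertible_mult matrix_mul_assoc)

lemma matrix_mult_uminus:
  fixes A B :: "int^2^2"
  shows "(- A) ** B = - (A ** B)" "A ** (- B) = - (A ** B)"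
  by (simp_all add: matrix_matrix_mult_def vec_eq_iff sum_negf)

lemma pm_eq: "pm A = {A, - A}"
  by (auto simp: pm_def r_coset_def GL2Z_def matrix_mult_uminus)

lemma carrier_PGL2Z: "carrier PGL2Z = pm ` {A. invertible A}"
  by (simp add: PGL2Z_def carrier_FactGroup pm_def[abs_def] GL2Z_def)

lemma mult_pm: "pm A \<otimes>\<^bsub>PGL2Z\<^esub> pm B = pm (A ** B)"
  by (auto simp: PGL2Z_def set_mult_def pm_eq GL2Z_def matrix_mult_uminus)

lemma one_PGL2Z: "\<one>\<^bsub>PGL2Z\<^esub> = pm (mat 1)"
  by (simp add: PGL2Z_def pm_eq)

lemma invertible_int_iff:
  fixes A :: "int^2^2"
  shows "invertible A \<longleftrightarrow> det A = 1 \<or> det A = -1"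
proof
  assume "invertible A"
  then obtain B where "A ** B = mat 1" by (auto simp: invertible_def)
  then have "det A * det B = 1" by (metis det_mul det_I)
  then show "det A = 1 \<or> det A = -1" by (simp add: zmult_eq_1_iff) blast
next
  define B where "B = mat2 (det A * A$2$2) (- det A * A$1$2) (- det A * A$2$1) (det A * A$1$1)"
  assume d: "det A = 1 \<or> det A = -1"
  then have "det A * det A = 1" by auto
  then have "A ** B = mat 1" "B ** A = mat 1"
    using d by (auto simp: B_def mat2_def vec_eq_iff forall_2 matrix_matrix_mult_def sum_2 mat_def
        det_2 algebra_simps)
  then show "invertible A" by (auto simp: invertible_def)
qed

lemma normal_pm1: "{mat 1, - mat 1} \<lhd> GL2Z"
proof -
  interpret group GL2Z by (rule group_GL2Z)
  have *: "invertible (- mat 1 :: int^2^2)"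
    by (auto simp: invertible_def matrix_mult_uminus intro!: exI[of _ "- mat 1"])
  have i: "inv\<^bsub>GL2Z\<^esub> (- mat 1) = - mat 1" "inv\<^bsub>GL2Z\<^esub> (mat 1) = mat 1"
    by (rule inv_equality; use * in \<open>simp add: GL2Z_def matrix_mult_uminus invertible_int_iff\<close>)+
  have "subgroup {mat 1, - mat 1} GL2Z"
  proof (rule subgroupI)
    show "{mat 1, - mat 1} \<subseteq> carrier GL2Z"
      using * by (auto simp: GL2Z_def invertible_int_iff)
    show "inv\<^bsub>GL2Z\<^esub> a \<in> {mat 1, - mat 1}" if "a \<in> {mat 1, - mat 1}" for a
      using that i by auto
  qed (auto simp: GL2Z_def matrix_mult_uminus)
  then show ?thesis
    by (rule normalI) (auto simp: r_coset_def l_coset_def GL2Z_def matrix_mult_uminus)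
qed

lemma group_PGL2Z: "group PGL2Z"
  unfolding PGL2Z_def by (rule normal.factorgroup_is_group[OF normal_pm1])

lemma subgroup_PSL2Z: "subgroup (carrier PSL2Z) PGL2Z"
proof -
  interpret group PGL2Z by (rule group_PGL2Z)
  show ?thesis
  proof (rule subgroupI)
    show "carrier PSL2Z \<subseteq> carrier PGL2Z"
      by (auto simp: PSL2Z_def carrier_PGL2Z invertible_int_iff)
    show "carrier PSL2Z \<noteq> {}"
      by (auto simp: PSL2Z_def intro!: exI[of _ "mat 1"])
    show "a \<otimes>\<^bsub>PGL2Z\<^esub> b \<in> carrier PSL2Z" if "a \<in> carrier PSL2Z" "b \<in> carrier PSL2Z" for a b
      using that by (auto simp: PSL2Z_def mult_pm det_mul)
    fix a assume "a \<in> carrier PSL2Z"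
    then obtain A where A: "a = pm A" "det A = 1" by (auto simp: PSL2Z_def)
    then obtain B where B: "A ** B = mat 1" "B ** A = mat 1"
      using invertible_int_iff[of A] by (auto simp: invertible_def)
    then have "det B = 1" using A by (metis det_I det_mul mult_1)
    moreover have "inv\<^bsub>PGL2Z\<^esub> a = pm B"
      using A B \<open>det B = 1\<close>
      by (intro inv_equality) (auto simp: mult_pm one_PGL2Z carrier_PGL2Z invertible_int_iff)
    ultimately show "inv\<^bsub>PGL2Z\<^esub> a \<in> carrier PSL2Z" by (auto simp: PSL2Z_def)
  qed
qed

lemma group_PSL2Z: "group PSL2Z"
  using subgroup.subgroup_is_group[OF subgroup_PSL2Z group_PGL2Z] by (simp add: PSL2Z_def)

lemma tau_eq: "tau = pm (mat2 1 1 0 1)"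
proof -
  have "mat2 0 (-1) 1 0 ** mat2 0 (-1) 1 1 = - mat2 1 1 0 1"
    by (auto simp: mat2_def vec_eq_iff forall_2 matrix_matrix_mult_def sum_2)
  then show ?thesis by (simp add: tau_def omega_def phi_def mult_pm) (auto simp: pm_eq)
qed

end

theory Submission
  imports Defs "HOL-Algebra.Generated_Groups"
begin

text \<open>
  Write \<open>U\<close> for the given Neumann subgroup, \<open>S = U \<inter> M\<close>, and suppose \<open>S \<subset> K\<close> with \<open>K\<close> nonparabolic
  in \<open>M\<close>. An element of \<open>K - S\<close> factors as \<open>s \<tau>\<^sup>b \<nu>\<close> with \<open>s \<in> U - S\<close>, and since \<open>K\<close> is nonparabolic,
  \<open>b\<close> is the same for all these elements. Put \<open>\<rho> = \<tau>\<^sup>b \<nu>\<close>, an involution. Then \<open>K = S \<union> (U - S) \<rho>\<close> is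
  normalised by \<open>\<rho>\<close>, and \<open>K\<close> is a Neumann subgroup of \<open>M\<close>. So the cosets \<open>K \<tau>\<^sup>n\<close> are indexed by the
  integers, and \<open>\<omega>\<close> acts on them by an involution \<open>f\<close>. As \<open>\<phi> = \<omega>\<tau>\<close> has order 3, so has
  \<open>n \<mapsto> f n + 1\<close>, and as \<open>\<rho>\<close> normalises \<open>K\<close> and \<open>\<nu>\<close> commutes with \<open>\<omega>\<close>, \<open>f\<close> commutes with
  \<open>n \<mapsto> b - n\<close>. No such \<open>f\<close> exists.
\<close>

section \<open>Involutions of the integers commuting with a reflection\<close>

lemma no_reflection_symmetric_action:
  fixes f :: "int \<Rightarrow> int" and b :: int
  assumes inv: "\<And>n. f (f n) = n" and ord: "\<And>n. f (f (f n + 1) + 1) + 1 = n"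
    and sym: "\<And>n. f (b - n) = b - f n"
  shows False
proof (cases "even b")
  case True
  then obtain c where b: "b = 2 * c" by (elim evenE)
  \<comment> \<open>The reflection fixes its centre \<open>c\<close>, hence so does
    \<open>f\<close>. With \<open>ord\<close> at \<open>c\<close> and \<open>sym\<close> at
    \<open>c + 1\<close> this forces \<open>2 * f (c + 1) = b - 1\<close>, against parity.\<close>
  have "f c = c" using sym[of c] b by simp
  then have "f (f (c + 1) + 1) = c - 1" using ord[of c] by simp
  then have "f (c + 1) + 1 = f (c - 1)" using inv by metis
  also have "\<dots> = b - f (c + 1)" using sym[of "c + 1"] b by (simp add: algebra_simps)
  finally show False using b by presburger
next
  case False
  then obtain c where b: "b = 2 * c + 1" by (elim oddE)
  \<comment> \<open>The reflection now swaps \<open>c\<close> and \<open>c + 1\<close>. By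
    \<open>ord\<close> at \<open>c + 1\<close>, \<open>f\<close> agrees with the reflection at
    \<open>u + 1\<close>; \<open>ord\<close> at the mirror image of \<open>u + 1\<close> then gives
    \<open>f (u + 2) = c\<close>, so \<open>2 * u + 2 = b\<close>.\<close>
  define u where "u = f (c + 1)"
  have fc: "f c = b - u" using sym[of "c + 1"] b by (simp add: u_def)
  have "f (f (u + 1) + 1) = c" using ord[of "c + 1"] by (simp add: u_def)
  then have "f (u + 1) + 1 = b - u" using inv fc by metis
  then have 1: "f (u + 1) = b - (u + 1)" by simp
  then have "f (b - (u + 1)) = u + 1" using inv by metis
  then have "f (f (u + 2) + 1) = b - (u + 2)" using ord[of "b - (u + 1)"] by (simp add: algebra_simps)
  then have "f (u + 2) + 1 = f (b - (u + 2))" using inv by metis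
  then have "f (u + 2) = c" using sym[of "u + 2"] b by linarith
  then have "u + 2 = b - u" using inv fc by metis
  then show False using b by presburger
qed

section \<open>Relations in an abstract extended modular group\<close>

text \<open>The intended model is \<open>PGL2Z\<close> with \<open>PSL2Z\<close> as \<open>M\<close>
  and \<open>tau\<close>, \<open>nu\<close>, \<open>omega\<close> as \<open>t\<close>,
  \<open>v\<close>, \<open>w\<close>. Together \<open>t\<close> and \<open>v\<close> generate an
  infinite dihedral group with reflections outside \<open>M\<close>.\<close>

locale extended_modular = group G for G (structure) +
  fixes M and t v w
  assumes subgroup_M: "subgroup M G"
    and t_in_M: "t \<in> M" and w_in_M: "w \<in> M"
    and v_closed: "v \<in> carrier G" and v_notin_M: "v \<notin> M"
    and index_2: "\<And>x y. x \<in> carrier G \<Longrightarrow> y \<in> carrier G \<Longrightarrow> x \<notin> M \<Longrightarrow> y \<notin> M \<Longrightarrow> x \<otimes> y \<in> M"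
    and vv: "v \<otimes> v = \<one>"
    and vtvt: "v \<otimes> t \<otimes> (v \<otimes> t) = \<one>"
    and ww: "w \<otimes> w = \<one>"
    and vw: "v \<otimes> w = w \<otimes> v"
    and wt3: "w \<otimes> t \<otimes> (w \<otimes> t) \<otimes> (w \<otimes> t) = \<one>"
    and t_inf: "\<And>n::int. t [^] n = \<one> \<Longrightarrow> n = 0"
begin

lemma t_closed: "t \<in> carrier G" and w_closed: "w \<in> carrier G"
  using subgroup.subset[OF subgroup_M] t_in_M w_in_M by auto

lemma tpow_in_M: "t [^] (n::int) \<in> M"
  using subgroup_int_pow_closed[OF subgroup_M t_in_M] .

lemma inv_v: "inv v = v"
  using vv v_closed by (simp add: inv_equality)

lemma inv_w: "inv w = w"
  using ww w_closed by (simp add: inv_equality)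

lemma inv_cancel:
  assumes "x \<in> carrier G" "y \<in> carrier G"
  shows "inv x \<otimes> (x \<otimes> y) = y" "x \<otimes> (inv x \<otimes> y) = y"
  using assms by (simp_all add: m_assoc[symmetric])

text \<open>Conjugation by the involution \<open>v\<close> inverts \<open>t\<close>. Natural powers
  follow by induction, negative ones by solving the natural case for the power times
  \<open>v\<close>.\<close>

lemma v_tpow: "v \<otimes> t [^] (n::int) = t [^] (- n) \<otimes> v"
proof -
  have "inv t = v \<otimes> t \<otimes> v"
    using vtvt t_closed v_closed by (intro inv_equality) (simp_all add: m_assoc)
  then have "v \<otimes> t = inv t \<otimes> v"
    using t_closed v_closed vv by (simp add: m_assoc)
  then have nat: "v \<otimes> t [^] (k::nat) = inv (t [^] k) \<otimes> v" for k
  proof (induction k)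
    case (Suc k)
    have "v \<otimes> (t [^] k \<otimes> t) = v \<otimes> t [^] k \<otimes> t"
      using t_closed v_closed by (simp add: m_assoc)
    also have "\<dots> = inv (t [^] k) \<otimes> (v \<otimes> t)"
      using Suc t_closed v_closed by (simp add: m_assoc)
    also have "\<dots> = inv (t [^] k) \<otimes> inv t \<otimes> v"
      using Suc t_closed v_closed by (simp add: m_assoc)
    also have "inv (t [^] k) \<otimes> inv t = inv (t [^] Suc k)"
      using t_closed by (simp add: inv_mult_group[symmetric] nat_pow_Suc2[symmetric] del: nat_pow_Suc)
    finally show ?case by simp
  qed (use v_closed in simp)
  show ?thesis
  proof (cases n)
    case (nonneg k)
    then show ?thesis using nat[of k] t_closed by (simp add: int_pow_neg int_pow_int)
  next
    case (neg k)
    have "t [^] (Suc k) \<otimes> v \<otimes> t [^] (Suc k) = v"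
      using nat[of "Suc k"] t_closed v_closed inv_cancel(2)[of "t [^] Suc k" v]
      by (simp add: m_assoc del: nat_pow_Suc)
    then have "t [^] (Suc k) \<otimes> v = v \<otimes> inv (t [^] (Suc k))"
      using t_closed v_closed by (simp add: inv_solve_right del: nat_pow_Suc)
    then show ?thesis using neg t_closed by (simp only: minus_minus int_pow_neg int_pow_int)
  qed
qed

lemma tpow_add: "t [^] (m::int) \<otimes> t [^] n = t [^] (m + n)"
  using t_closed by (simp add: int_pow_mult)

lemma tpow_add_assoc: "x \<in> carrier G \<Longrightarrow> t [^] (m::int) \<otimes> (t [^] n \<otimes> x) = t [^] (m + n) \<otimes> x"
  using t_closed by (simp add: int_pow_mult m_assoc)

lemma v_tpow_assoc: "x \<in> carrier G \<Longrightarrow> v \<otimes> (t [^] (n::int) \<otimes> x) = t [^] (- n) \<otimes> (v \<otimes> x)"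
  using t_closed v_closed v_tpow[of n] by (simp add: m_assoc[symmetric])

lemma vv_assoc: "x \<in> carrier G \<Longrightarrow> v \<otimes> (v \<otimes> x) = x"
  using vv v_closed by (simp add: m_assoc[symmetric])

lemma ww_assoc: "x \<in> carrier G \<Longrightarrow> w \<otimes> (w \<otimes> x) = x"
  using ww w_closed by (simp add: m_assoc[symmetric])

lemma vw_assoc: "x \<in> carrier G \<Longrightarrow> v \<otimes> (w \<otimes> x) = w \<otimes> (v \<otimes> x)"
  using vw w_closed v_closed by (simp add: m_assoc[symmetric])

lemma inv_tpow: "inv (t [^] (n::int)) = t [^] (- n)"
  using t_closed by (simp add: int_pow_neg)

text \<open>A rewriting system for words: products nest to the right, powers of \<open>t\<close>
  merge, and \<open>v\<close> moves right past \<open>t\<close> and \<open>w\<close>. The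
  \<open>_assoc\<close> rules do this in front of a further factor.\<close>

lemmas words = m_assoc inv_mult_group inv_cancel inv_v inv_w inv_tpow v_tpow v_tpow_assoc
  tpow_add tpow_add_assoc vv vv_assoc ww ww_assoc vw vw_assoc t_closed v_closed w_closed

definition T_ext :: "'a set" where
  "T_ext = {t [^] (n::int) | n. True} \<union> {t [^] (n::int) \<otimes> v | n. True}"

text \<open>As \<open>t\<close> has infinite order, a conjugate of \<open>t [^] n\<close> is trivial
  only for \<open>n = 0\<close>, so nontriviality is expressed through the exponent.\<close>

definition nonparabolic :: "'a set \<Rightarrow> bool" where
  "nonparabolic K \<longleftrightarrow> (\<forall>h\<in>M. \<forall>n::int. h \<otimes> t [^] n \<otimes> inv h \<in> K \<longrightarrow> n = 0)"

text \<open>Conjugation by \<open>v\<close> inverts \<open>t\<close>, so conjugates by elements outside \<open>M\<close> are parabolic too.\<close>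

lemma nonparabolicD:
  assumes K: "nonparabolic K" and g: "g \<in> carrier G" and in_K: "g \<otimes> t [^] (n::int) \<otimes> inv g \<in> K"
  shows "n = 0"
proof (cases "g \<in> M")
  case True
  then show ?thesis using K in_K by (auto simp: nonparabolic_def)
next
  case False
  have "g \<otimes> v \<in> M" using index_2[OF g v_closed False v_notin_M] .
  moreover have "(g \<otimes> v) \<otimes> t [^] (- n) \<otimes> inv (g \<otimes> v) = g \<otimes> t [^] n \<otimes> inv g"
    using g by (simp add: words)
  ultimately have "- n = 0" using K in_K unfolding nonparabolic_def by metis
  then show ?thesis by simp
qed

section \<open>Neumann subgroups not contained in M\<close>

context
  fixes U assumes neumann: "neumann_subgroup G T_ext U" and not_sub: "\<not> U \<subseteq> M"
begin

lemma subgroup_U: "subgroup U G"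
  using neumann by (simp add: neumann_subgroup_def)

lemma U_closed: "s \<in> U \<Longrightarrow> s \<in> carrier G"
  using subgroup.subset[OF subgroup_U] by auto

lemma M_closed: "s \<in> M \<Longrightarrow> s \<in> carrier G"
  using subgroup.subset[OF subgroup_M] by auto

lemma decompose:
  assumes "x \<in> carrier G"
  obtains (rot) s n where "s \<in> U" "x = s \<otimes> t [^] (n::int)"
    | (refl) s n where "s \<in> U" "x = s \<otimes> (t [^] (n::int) \<otimes> v)"
proof -
  have "x \<in> U <#> T_ext" using assms neumann by (simp add: neumann_subgroup_def)
  then show thesis using rot refl unfolding set_mult_def T_ext_def by blast
qed

lemma tpow_in_U: "t [^] (n::int) \<in> U \<Longrightarrow> n = 0"
  using neumann t_inf unfolding neumann_subgroup_def T_ext_def by blast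

lemma reflection_notin_M: "t [^] (n::int) \<otimes> v \<notin> M"
  using subgroup_M v_notin_M tpow_in_M[of n] v_closed subgroup.mem_carrier
  by (metis inv_cancel(1) subgroup.m_closed subgroup.m_inv_closed)

lemma reflection_notin_U: "t [^] (n::int) \<otimes> v \<notin> U"
proof
  assume "t [^] n \<otimes> v \<in> U"
  then have "t [^] n \<otimes> v = \<one>" using neumann by (auto simp: neumann_subgroup_def T_ext_def)
  then show False using reflection_notin_M[of n] subgroup.one_closed[OF subgroup_M] by simp
qed

text \<open>Write \<open>g\<close> as an element \<open>s\<close> of \<open>U\<close> times an
  element of \<open>T_ext\<close>. The latter sends \<open>t [^] n\<close> to itself or its inverse,
  and conjugating \<open>s\<close> away inside \<open>U\<close> leaves a power of \<open>t\<close>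
  in \<open>U\<close>.\<close>

lemma conj_tpow_in_U:
  assumes g: "g \<in> carrier G" and in_U: "g \<otimes> t [^] (n::int) \<otimes> inv g \<in> U"
  shows "n = 0"
  using g
proof (cases rule: decompose)
  case (rot s m)
  then have "inv s \<otimes> (g \<otimes> t [^] n \<otimes> inv g) \<otimes> s \<in> U"
    using in_U subgroup_U by (simp add: subgroup.m_closed subgroup.m_inv_closed)
  moreover have "inv s \<otimes> (g \<otimes> t [^] n \<otimes> inv g) \<otimes> s = t [^] n"
    using rot U_closed by (simp add: words)
  ultimately show ?thesis using tpow_in_U by simp
next
  case (refl s m)
  then have "inv s \<otimes> (g \<otimes> t [^] n \<otimes> inv g) \<otimes> s \<in> U"
    using in_U subgroup_U by (simp add: subgroup.m_closed subgroup.m_inv_closed)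
  moreover have "inv s \<otimes> (g \<otimes> t [^] n \<otimes> inv g) \<otimes> s = t [^] (- n)"
    using refl U_closed by (simp add: words)
  ultimately show ?thesis using tpow_in_U[of "- n"] by simp
qed

lemma nonparabolic_even_part: "nonparabolic (U \<inter> M)"
  using conj_tpow_in_U M_closed by (auto simp: nonparabolic_def)

text \<open>For \<open>s\<close> in \<open>U - M\<close>, a factorization of
  \<open>s \<otimes> v\<close> over \<open>U \<inter> M\<close> would put a reflection
  \<open>t [^] n \<otimes> v\<close> into \<open>U\<close>.\<close>

lemma even_part_not_neumann: "(U \<inter> M) <#> {t [^] (n::int) | n. True} \<noteq> M"
proof
  assume eq: "(U \<inter> M) <#> {t [^] (n::int) | n. True} = M"
  obtain s where s: "s \<in> U" "s \<notin> M" using not_sub by blast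
  have "s \<otimes> v \<in> M" using index_2 s U_closed v_closed v_notin_M by blast
  then obtain r n where r: "r \<in> U" "s \<otimes> v = r \<otimes> t [^] (n::int)"
    using eq unfolding set_mult_def by blast
  have "inv r \<otimes> s = inv r \<otimes> (s \<otimes> v) \<otimes> v" using r(1) s(1) U_closed by (simp add: words)
  also have "\<dots> = t [^] n \<otimes> v" unfolding r(2) using r(1) U_closed by (simp add: words)
  finally have "t [^] n \<otimes> v \<in> U"
    using r s subgroup_U by (metis subgroup.m_closed subgroup.m_inv_closed)
  then show False using reflection_notin_U by blast
qed

text \<open>Index two makes membership in \<open>M\<close> a parity: a product is even iff its
  factors have equal parity.\<close>

lemma M_iff_mult:
  assumes "x \<in> carrier G" "y \<in> carrier G"
  shows "x \<otimes> y \<in> M \<longleftrightarrow> (x \<in> M \<longleftrightarrow> y \<in> M)"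
proof -
  have "x \<otimes> y \<in> M" if "x \<in> M" "y \<in> M" using that subgroup_M by (simp add: subgroup.m_closed)
  moreover have "y \<in> M" if "x \<in> M" "x \<otimes> y \<in> M"
    using that assms subgroup_M by (metis inv_cancel(1) subgroup.m_closed subgroup.m_inv_closed)
  moreover have "x \<in> M" if "y \<in> M" "x \<otimes> y \<in> M"
    using that assms subgroup_M by (metis inv_solve_right subgroup.m_closed subgroup.m_inv_closed M_closed)
  ultimately show ?thesis using index_2 assms by blast
qed

section \<open>Maximality of the even part\<close>

lemma no_larger_nonparabolic:
  assumes K: "subgroup K G" "K \<subseteq> M" and np: "nonparabolic K" and sub: "U \<inter> M \<subseteq> K"
  shows "K \<subseteq> U"
proof (rule ccontr)
  have mem_M: "x \<otimes> t [^] (n::int) \<in> M \<longleftrightarrow> x \<in> M" "x \<otimes> (t [^] (n::int) \<otimes> v) \<in> M \<longleftrightarrow> x \<notin> M"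
    if "x \<in> carrier G" for x n
    using that tpow_in_M reflection_notin_M v_closed t_closed by (simp_all add: M_iff_mult)
  have K_closed: "x \<in> carrier G" if "x \<in> K" for x using that K M_closed by auto
  note Km = subgroup.m_closed[OF K(1)] and Ki = subgroup.m_inv_closed[OF K(1)]
  note Um = subgroup.m_closed[OF subgroup_U] and Ui = subgroup.m_inv_closed[OF subgroup_U]
  have inv_M: "inv x \<in> M \<longleftrightarrow> x \<in> M" if "x \<in> carrier G" for x
    using that subgroup_M by (metis inv_inv subgroup.m_inv_closed)
  have tK: "n = 0" if "t [^] (n::int) \<in> K" for n
    using nonparabolicD[OF np one_closed, of n] that t_closed by simp
  \<comment> \<open>A factorization without \<open>v\<close> is impossible: its \<open>s\<close>
    would lie in \<open>U \<inter> M\<close>, hence in \<open>K\<close>, so the power of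
    \<open>t\<close> would lie in \<open>K\<close> and be trivial, giving \<open>k = s\<close> in
    \<open>U\<close>.\<close>
  have off: "\<exists>s n. s \<in> U \<and> s \<notin> M \<and> k = s \<otimes> (t [^] (n::int) \<otimes> v)" if k: "k \<in> K" "k \<notin> U" for k
    using K_closed[OF k(1)]
  proof (cases rule: decompose)
    case (rot s n)
    then have "s \<in> K" using k K sub mem_M U_closed by blast
    then have "inv s \<otimes> k \<in> K" using k Km Ki by blast
    then have "n = 0" using rot tK U_closed by (simp add: words)
    then show ?thesis using rot k U_closed by simp
  next
    case (refl s n)
    then show ?thesis using k K mem_M U_closed by blast
  qed
  assume "\<not> K \<subseteq> U"
  then obtain k where k: "k \<in> K" "k \<notin> U" by blast
  then obtain s b where s: "s \<in> U" "s \<notin> M" "k = s \<otimes> (t [^] (b::int) \<otimes> v)" using off by blast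
  define r where "r = t [^] b \<otimes> v"
  have r: "r \<in> carrier G" "r \<otimes> r = \<one>" "inv r = r" by (simp_all add: r_def words)
  have rr: "r \<otimes> (r \<otimes> x) = x" if "x \<in> carrier G" for x
    using that r by (simp add: m_assoc[symmetric])
  \<comment> \<open>\<open>U - M\<close> is a single coset of \<open>U \<inter> M\<close>, so one
    element \<open>s \<otimes> r\<close> of \<open>K\<close> yields all the others.\<close>
  have in_K: "q \<otimes> r \<in> K" if "q \<in> U" "q \<notin> M" for q
  proof -
    have "q \<otimes> inv s \<in> U \<inter> M"
      using that s U_closed Um Ui by (simp add: M_iff_mult inv_M)
    then have "q \<otimes> inv s \<otimes> k \<in> K" using sub k Km by blast
    then show ?thesis using s that U_closed r by (simp add: r_def[symmetric] m_assoc inv_cancel)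
  qed
  \<comment> \<open>Dividing by \<open>q \<otimes> r\<close> leaves the conjugate of
    \<open>t [^] (c - b)\<close> by \<open>q\<close>. As \<open>q\<close> lies outside
    \<open>M\<close>, \<open>nonparabolicD\<close> is needed for arbitrary conjugators.\<close>
  have coset: "\<exists>q. q \<in> U \<and> q \<notin> M \<and> x = q \<otimes> r" if x: "x \<in> K" "x \<notin> U" for x
  proof -
    obtain q c where q: "q \<in> U" "q \<notin> M" "x = q \<otimes> (t [^] (c::int) \<otimes> v)" using off[OF x] by blast
    have "x \<otimes> inv (q \<otimes> r) \<in> K" using x q in_K Km Ki by blast
    moreover have "x \<otimes> inv (q \<otimes> r) = q \<otimes> t [^] (c - b) \<otimes> inv q"
      using q U_closed by (simp add: r_def words)
    ultimately have "c - b = 0" using nonparabolicD[OF np] q U_closed by metis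
    then show ?thesis using q by (auto simp: r_def)
  qed
  \<comment> \<open>Otherwise the square of \<open>q \<otimes> r\<close> lies in
    \<open>K - U\<close> and equals some \<open>p \<otimes> r\<close>; cancelling gives
    \<open>q \<otimes> r \<otimes> q = p\<close>, which puts the reflection \<open>r\<close> into
    \<open>U\<close>.\<close>
  have rUr: "r \<otimes> q \<otimes> r \<in> U" if q: "q \<in> U" "q \<notin> M" for q
  proof (rule ccontr)
    assume no: "r \<otimes> q \<otimes> r \<notin> U"
    have "(q \<otimes> r) \<otimes> (q \<otimes> r) \<in> K" using in_K q Km by blast
    moreover have "(q \<otimes> r) \<otimes> (q \<otimes> r) \<notin> U"
    proof
      assume "(q \<otimes> r) \<otimes> (q \<otimes> r) \<in> U"
      then have "inv q \<otimes> ((q \<otimes> r) \<otimes> (q \<otimes> r)) \<in> U" using q Um Ui by blast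
      then show False using no q U_closed r by (simp add: m_assoc inv_cancel)
    qed
    ultimately obtain p where p: "p \<in> U" "(q \<otimes> r) \<otimes> (q \<otimes> r) = p \<otimes> r" using coset by blast
    then have "q \<otimes> r \<otimes> q = p" using q r U_closed by (metis m_assoc m_closed right_cancel)
    then have "inv q \<otimes> (q \<otimes> r \<otimes> q) \<otimes> inv q \<in> U" using p q Um Ui by blast
    then have "r \<in> U" using q r U_closed by (simp add: m_assoc inv_cancel)
    then show False using reflection_notin_U by (simp add: r_def)
  qed
  \<comment> \<open>An even \<open>x\<close> in \<open>U\<close> is the quotient of the two odd
    elements \<open>s\<close> and \<open>s \<otimes> x\<close> of \<open>U\<close>, to which
    \<open>rUr\<close> applies.\<close>
  have rKr: "r \<otimes> x \<otimes> r \<in> K" if x: "x \<in> K" for x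
  proof (cases "x \<in> U")
    case True
    have "x \<in> M" using x K by blast
    then have "s \<otimes> x \<notin> M" "s \<otimes> x \<in> U" using s True U_closed Um by (simp_all add: M_iff_mult)
    then have "inv (r \<otimes> s \<otimes> r) \<otimes> (r \<otimes> (s \<otimes> x) \<otimes> r) \<in> U" using s rUr Um Ui by blast
    then have "r \<otimes> x \<otimes> r \<in> U"
      using s(1) True U_closed r rr by (simp add: m_assoc inv_cancel inv_mult_group)
    moreover have "r \<otimes> x \<otimes> r \<in> M"
      using \<open>x \<in> M\<close> r M_closed by (simp add: M_iff_mult)
    ultimately show ?thesis using sub by blast
  next
    case False
    then obtain q where q: "q \<in> U" "q \<notin> M" "x = q \<otimes> r" using coset x by blast
    then have "r \<otimes> x \<otimes> r = (r \<otimes> q \<otimes> r) \<otimes> r" using r U_closed by (simp add: m_assoc)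
    moreover have "r \<otimes> q \<otimes> r \<notin> M"
      using q r U_closed by (simp add: M_iff_mult)
    ultimately show ?thesis using in_K rUr q by simp
  qed
  \<comment> \<open>The powers of \<open>t\<close> represent all cosets of \<open>K\<close> in
    \<open>M\<close>. In the reflected case \<open>r\<close> absorbs \<open>v\<close>:
    \<open>t [^] n \<otimes> v\<close> equals \<open>r \<otimes> t [^] (b - n)\<close>.\<close>
  have "\<exists>m::int. x \<otimes> t [^] (- m) \<in> K" if x: "x \<in> M" for x
    using M_closed[OF x]
  proof (cases rule: decompose)
    case (rot q n)
    then have "q \<in> K" using x sub mem_M U_closed by blast
    then have "x \<otimes> t [^] (- n) \<in> K" using rot U_closed by (simp add: words)
    then show ?thesis by blast
  next
    case (refl q n)
    then have "q \<otimes> r \<in> K" using x in_K mem_M U_closed by blast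
    then have "x \<otimes> t [^] (- (b - n)) \<in> K" using refl U_closed by (simp add: r_def words)
    then show ?thesis by blast
  qed
  moreover have "t [^] n \<otimes> w \<in> M" for n :: int
    using subgroup_M tpow_in_M w_in_M by (simp add: subgroup.m_closed)
  ultimately have "\<exists>m::int. t [^] n \<otimes> w \<otimes> t [^] (- m) \<in> K" for n :: int by blast
  \<comment> \<open>Right multiplication by \<open>w\<close> takes the coset of
    \<open>t [^] n\<close> to that of \<open>t [^] f n\<close>; by \<open>tK\<close> this value is
    unique.\<close>
  then obtain f :: "int \<Rightarrow> int" where f: "t [^] n \<otimes> w \<otimes> t [^] (- f n) \<in> K" for n :: int by metis
  have f_eq: "f n = m" if "t [^] n \<otimes> w \<otimes> t [^] (- m) \<in> K" for n m
  proof -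
    have "inv (t [^] n \<otimes> w \<otimes> t [^] (- f n)) \<otimes> (t [^] n \<otimes> w \<otimes> t [^] (- m)) \<in> K"
      using f that Km Ki by blast
    then have "f n - m = 0" by (intro tK) (simp add: words)
    then show ?thesis by simp
  qed
  have "f (f n) = n" for n
    using Ki[OF f[of n]] by (intro f_eq) (simp add: words)
  \<comment> \<open>Three consecutive witnesses telescope to a word around \<open>w t w t w\<close>,
    which is the inverse of \<open>t\<close> by \<open>wt3\<close>; what remains is
    \<open>t [^] (n - 1 - f z)\<close>.\<close>
  moreover have "f (f (f n + 1) + 1) + 1 = n" for n
  proof -
    have wtw: "w \<otimes> (t \<otimes> (w \<otimes> (t \<otimes> (w \<otimes> x)))) = inv t \<otimes> x" if "x \<in> carrier G" for x
    proof -
      have "w \<otimes> t \<otimes> (w \<otimes> t) \<otimes> w = inv t"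
        using wt3 t_closed w_closed by (intro inv_equality[symmetric]) (simp_all add: m_assoc)
      then show ?thesis using that t_closed w_closed by (simp add: m_assoc[symmetric])
    qed
    have t1: "t [^] (1::int) = t" using t_closed by simp
    define y z where "y = f n + 1" and "z = f y + 1"
    have "(t [^] n \<otimes> w \<otimes> t [^] (- f n)) \<otimes> (t [^] y \<otimes> w \<otimes> t [^] (- f y)) \<otimes>
        (t [^] z \<otimes> w \<otimes> t [^] (- f z)) \<in> K"
      using f Km by blast
    then have "t [^] n \<otimes> (w \<otimes> (t [^] (1::int) \<otimes> (w \<otimes> (t [^] (1::int) \<otimes> (w \<otimes> t [^] (- f z)))))) \<in> K"
      by (simp add: words y_def z_def)
    then have "t [^] n \<otimes> (t [^] (- 1 :: int) \<otimes> t [^] (- f z)) \<in> K"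
      using wtw[of "t [^] (- f z)"] t_closed by (simp only: t1 int_pow_neg int_pow_closed inv_closed)
    then have "n - 1 - f z = 0" by (intro tK) (simp add: words algebra_simps)
    then show ?thesis by (simp add: y_def z_def)
  qed
  \<comment> \<open>Conjugating the witness for \<open>n\<close> by \<open>r\<close> reflects both
    exponents about \<open>b\<close>, because \<open>v\<close> commutes with
    \<open>w\<close>.\<close>
  moreover have "f (b - n) = b - f n" for n
    using rKr[OF f[of n]] by (intro f_eq) (simp add: r_def words algebra_simps)
  ultimately show False by (rule no_reflection_symmetric_action)
qed

end

end

section \<open>Integer matrices up to sign\<close>

lemma mat2_mult: "mat2 a b c d ** mat2 a' b' c' d' =
    mat2 (a * a' + b * c') (a * b' + b * d') (c * a' + d * c') (c * b' + d * d')"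
  by (simp add: mat2_def vec_eq_iff forall_2 matrix_matrix_mult_def sum_2)

lemma det_mat2: "det (mat2 a b c d) = a * d - b * c"
  by (simp add: mat2_def det_2)

lemma mat2_eq_iff: "mat2 a b c d = mat2 a' b' c' d' \<longleftrightarrow> a = a' \<and> b = b' \<and> c = c' \<and> d = d'"
  by (auto simp: mat2_def vec_eq_iff forall_2)

lemma uminus_mat2: "- mat2 a b c d = mat2 (- a) (- b) (- c) (- d)"
  by (simp add: mat2_def vec_eq_iff forall_2)

lemma mat_1_mat2: "mat 1 = mat2 1 0 0 1"
  by (simp add: mat2_def vec_eq_iff forall_2 mat_def)

lemma pm_eq_iff: "pm A = pm B \<longleftrightarrow> A = B \<or> A = - B"
  by (auto simp: pm_eq doubleton_eq_iff)

text \<open>In even dimension the sign cancels, so the determinant is well defined on the cosets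
  \<open>pm A\<close>.\<close>

lemma det_uminus_2: "det (- A :: int^2^2) = det A"
  by (simp add: det_2)

lemma pm_in_PSL2Z: "pm A \<in> carrier PSL2Z \<longleftrightarrow> det A = 1"
  by (auto simp: PSL2Z_def pm_eq_iff det_uminus_2)

lemma pm_in_PGL2Z: "pm A \<in> carrier PGL2Z \<longleftrightarrow> det A = 1 \<or> det A = -1"
  by (auto simp: carrier_PGL2Z invertible_int_iff pm_eq_iff det_uminus_2)

lemma tau_nat_pow: "tau [^]\<^bsub>PGL2Z\<^esub> (n::nat) = pm (mat2 1 (int n) 0 1)"
proof (induction n)
  case (Suc n)
  then show ?case by (simp add: tau_eq mult_pm mat2_mult)
qed (simp add: one_PGL2Z mat_1_mat2)

lemma tau_inf:
  assumes "tau [^]\<^bsub>PGL2Z\<^esub> (n::int) = \<one>\<^bsub>PGL2Z\<^esub>"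
  shows "n = 0"
proof -
  interpret group PGL2Z by (rule group_PGL2Z)
  have tau: "tau \<in> carrier PGL2Z" by (simp add: tau_eq pm_in_PGL2Z det_mat2)
  obtain k where k: "n = int k \<or> n = - int k" by (metis int_cases2)
  then have "tau [^]\<^bsub>PGL2Z\<^esub> k = \<one>\<^bsub>PGL2Z\<^esub>"
  proof
    assume "n = int k"
    then show ?thesis using assms by (simp add: int_pow_int)
  next
    assume "n = - int k"
    then have "inv\<^bsub>PGL2Z\<^esub> (tau [^]\<^bsub>PGL2Z\<^esub> k) = \<one>\<^bsub>PGL2Z\<^esub>"
      using assms int_pow_neg_int[OF tau, of k] by simp
    then show ?thesis using inv_eq_1_iff[OF nat_pow_closed[OF tau, of k]] by simp
  qed
  \<comment> \<open>The diagonal entries exclude the negative sign; the upper right entry is then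
    \<open>k = 0\<close>.\<close>
  then have "k = 0"
    unfolding tau_nat_pow one_PGL2Z mat_1_mat2 by (simp add: pm_eq_iff mat2_eq_iff uminus_mat2)
  then show ?thesis using k by auto
qed

text \<open>Several relations hold only up to sign: \<open>omega\<close> squared and
  \<open>omega tau\<close> cubed are represented by minus the identity, and the matrices of
  \<open>nu\<close> and \<open>omega\<close> anticommute.\<close>

interpretation PGL2Z: extended_modular PGL2Z "carrier PSL2Z" tau nu omega
proof (intro extended_modular.intro extended_modular_axioms.intro group_PGL2Z subgroup_PSL2Z tau_inf)
  fix x y assume "x \<in> carrier PGL2Z" "y \<in> carrier PGL2Z" "x \<notin> carrier PSL2Z" "y \<notin> carrier PSL2Z"
  then show "x \<otimes>\<^bsub>PGL2Z\<^esub> y \<in> carrier PSL2Z"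
    by (auto simp: PSL2Z_def carrier_PGL2Z invertible_int_iff mult_pm det_mul)
next
  show "tau \<in> carrier PSL2Z" "omega \<in> carrier PSL2Z" "nu \<in> carrier PGL2Z" "nu \<notin> carrier PSL2Z"
    by (simp_all add: tau_eq nu_def omega_def pm_in_PSL2Z pm_in_PGL2Z det_mat2)
qed (simp_all add: tau_eq nu_def omega_def mult_pm mat2_mult one_PGL2Z mat_1_mat2
      pm_eq_iff mat2_eq_iff uminus_mat2)

lemma T_hat_eq: "T_hat = PGL2Z.T_ext"
proof -
  have "T_hat = (\<Union>e \<in> {0, 1::nat}. {tau [^]\<^bsub>PGL2Z\<^esub> n \<otimes>\<^bsub>PGL2Z\<^esub> nu [^]\<^bsub>PGL2Z\<^esub> e | n :: int. True})"
    unfolding T_hat_def by blast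
  then show ?thesis
    using PGL2Z.t_closed PGL2Z.v_closed by (simp add: PGL2Z.T_ext_def)
qed

section \<open>Transfer between PSL2Z and PGL2Z\<close>

lemma subgroup_PSL2Z_iff: "subgroup K PSL2Z \<longleftrightarrow> subgroup K PGL2Z \<and> K \<subseteq> carrier PSL2Z"
proof -
  have eq: "PSL2Z = PGL2Z\<lparr>carrier := carrier PSL2Z\<rparr>" by (simp add: PSL2Z_def)
  show ?thesis
    using PGL2Z.incl_subgroup[OF subgroup_PSL2Z, folded eq]
      PGL2Z.subgroup_incl[OF _ subgroup_PSL2Z, folded eq] subgroup.subset[of K PSL2Z] by blast
qed

text \<open>The operations of \<open>PSL2Z\<close> are restrictions from \<open>PGL2Z\<close>, and
  \<open>g\<close> being nontrivial becomes \<open>n\<close> being nonzero by the infinite order of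
  \<open>tau\<close>.\<close>

lemma parabolic_iff: "parabolic g \<longleftrightarrow>
  (\<exists>h \<in> carrier PSL2Z. \<exists>n::int. n \<noteq> 0 \<and>
    g = h \<otimes>\<^bsub>PGL2Z\<^esub> tau [^]\<^bsub>PGL2Z\<^esub> n \<otimes>\<^bsub>PGL2Z\<^esub> inv\<^bsub>PGL2Z\<^esub> h)"
proof -
  have eq: "PSL2Z = PGL2Z\<lparr>carrier := carrier PSL2Z\<rparr>" by (simp add: PSL2Z_def)
  have mult: "x \<otimes>\<^bsub>PSL2Z\<^esub> y = x \<otimes>\<^bsub>PGL2Z\<^esub> y" for x y by (simp add: PSL2Z_def)
  have one: "\<one>\<^bsub>PSL2Z\<^esub> = \<one>\<^bsub>PGL2Z\<^esub>" by (simp add: PSL2Z_def)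
  have pow: "tau [^]\<^bsub>PSL2Z\<^esub> n = tau [^]\<^bsub>PGL2Z\<^esub> n" for n :: int
    using PGL2Z.int_pow_consistent[OF subgroup_PSL2Z PGL2Z.t_in_M, of n, folded eq] by simp
  have inv: "inv\<^bsub>PSL2Z\<^esub> h = inv\<^bsub>PGL2Z\<^esub> h" if "h \<in> carrier PSL2Z" for h
    using PGL2Z.m_inv_consistent[OF subgroup_PSL2Z that, folded eq] .
  let ?c = "\<lambda>h (n::int). h \<otimes>\<^bsub>PGL2Z\<^esub> tau [^]\<^bsub>PGL2Z\<^esub> n \<otimes>\<^bsub>PGL2Z\<^esub> inv\<^bsub>PGL2Z\<^esub> h"
  have closed: "h \<in> carrier PGL2Z" if "h \<in> carrier PSL2Z" for h
    using that subgroup.subset[OF subgroup_PSL2Z] by blast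
  have conj: "?c h n = \<one>\<^bsub>PGL2Z\<^esub> \<longleftrightarrow> n = 0" if "h \<in> carrier PSL2Z" for h n
  proof
    assume "?c h n = \<one>\<^bsub>PGL2Z\<^esub>"
    moreover have "tau [^]\<^bsub>PGL2Z\<^esub> n = inv\<^bsub>PGL2Z\<^esub> h \<otimes>\<^bsub>PGL2Z\<^esub> ?c h n \<otimes>\<^bsub>PGL2Z\<^esub> h"
      using closed[OF that] PGL2Z.t_closed by (simp add: PGL2Z.m_assoc PGL2Z.inv_cancel)
    ultimately have "tau [^]\<^bsub>PGL2Z\<^esub> n = \<one>\<^bsub>PGL2Z\<^esub>" using closed[OF that] by simp
    then show "n = 0" by (rule PGL2Z.t_inf)
  qed (use closed[OF that] in simp)
  have "?c h n \<in> carrier PSL2Z" if "h \<in> carrier PSL2Z" for h n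
    using that subgroup_PSL2Z PGL2Z.tpow_in_M by (simp add: subgroup.m_closed subgroup.m_inv_closed)
  moreover have "parabolic g \<longleftrightarrow> g \<in> carrier PSL2Z \<and> g \<noteq> \<one>\<^bsub>PGL2Z\<^esub> \<and>
      (\<exists>h \<in> carrier PSL2Z. \<exists>n. g = ?c h n)"
    unfolding parabolic_def mult one pow using inv by (simp cong: bex_cong)
  ultimately show ?thesis using conj by blast
qed

lemma nonparabolic_subgroup_iff: "nonparabolic_subgroup K \<longleftrightarrow>
  subgroup K PGL2Z \<and> K \<subseteq> carrier PSL2Z \<and> PGL2Z.nonparabolic K"
  unfolding nonparabolic_subgroup_def subgroup_PSL2Z_iff parabolic_iff PGL2Z.nonparabolic_def by blast

theorem theorem10:
  fixes S_hat S :: "(int^2^2) set set"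
  assumes "neumann_subgroup PGL2Z T_hat S_hat"
    and "\<not> S_hat \<subseteq> carrier PSL2Z"
    and "S = S_hat \<inter> carrier PSL2Z"
  shows "maximal_nonparabolic S \<and> \<not> neumann_subgroup PSL2Z T_group S"
proof
  note N = assms(1)[unfolded T_hat_eq] assms(2)
  have "subgroup S PGL2Z"
    using assms subgroup_PSL2Z PGL2Z.subgroups_Inter_pair by (simp add: neumann_subgroup_def)
  then have "nonparabolic_subgroup S"
    using assms(3) PGL2Z.nonparabolic_even_part[OF N] by (simp add: nonparabolic_subgroup_iff)
  moreover have "K \<subseteq> S" if "nonparabolic_subgroup K" "S \<subseteq> K" for K
    using that PGL2Z.no_larger_nonparabolic[OF N, of K] assms(3)
    by (auto simp: nonparabolic_subgroup_iff)
  ultimately show "maximal_nonparabolic S" unfolding maximal_nonparabolic_def by blast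
  have "S <#>\<^bsub>PSL2Z\<^esub> T_group = S <#>\<^bsub>PGL2Z\<^esub> T_group"
    by (simp add: set_mult_def PSL2Z_def)
  then show "\<not> neumann_subgroup PSL2Z T_group S"
    using PGL2Z.even_part_not_neumann[OF N] assms(3)
    by (simp add: neumann_subgroup_def T_group_def)
qed

end
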